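(* Let $D$ be a non-empty set, $X$ a Banach space, and let $V\subseteq F(D,\mathbb K)$ and $W\subseteq F(D,X)$. If $V$ is a BKN-space and $W$ is a BK-space, then $M'(V,W)$, with its operator norm, is a BK-space.
   Context: $\mathbb K=\mathbb R$ or $\mathbb C$. $F(D,X)$ is the vector space of all functions $D\to X$. A BK-space in $F(D,X)$ is a vector subspace with a complete norm for which every evaluation $u\mapsto u(a)$, $a\in D$, is continuous into $X$. A BKN-space is a BK-space that does not vanish at any point, i.e. for every $a\in D$ some element $v$ of the space has $v(a)\ne0$. $M'(V,W):=\{f\in F(D,X): v\cdot f\in W\ \forall v\in V\}$, where $(v\cdot f)(a)=v(a)f(a)$, with operator norm $\|f\|_{M'(V,W)}:=\sup\{\|v\cdot f\|_W:v\in V,\ \|v\|_V\le1\}$. *)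

theory Defs
  imports "HOL-Analysis.Analysis" "HOL-Library.Function_Algebras"
begin

text \<open>
  The scalar field is a type of class \<^class>\<open>real_normed_field\<close>. Its norm is multiplicative and
  extends the absolute value of the reals, so by the Gelfand--Mazur theorem the real and the
  complex numbers are, up to isometric isomorphism, its only instances. The class
  \<^class>\<open>banach\<close> only provides real scalar multiplication; the scalar multiplication of a Banach
  space over the field is therefore an explicit parameter, required to extend the real one.
\<close>

locale normed_scaling = vector_space scl
  for scl :: "'k::real_normed_field \<Rightarrow> 'x::real_normed_vector \<Rightarrow> 'x" +
  assumes norm_scale: "norm (scl c x) = norm c * norm x"
    and scale_of_real: "scl (of_real r) x = r *\<^sub>R x"

lemma normed_scaling_real_iff:
  fixes scl :: "real \<Rightarrow> 'x::real_normed_vector \<Rightarrow> 'x"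
  shows "normed_scaling scl \<longleftrightarrow> scl = scaleR"
proof
  assume "normed_scaling scl"
  then interpret normed_scaling scl .
  show "scl = scaleR"
    using scale_of_real by (intro ext) simp
next
  assume "scl = scaleR"
  then show "normed_scaling scl"
    by (auto intro!: normed_scaling.intro normed_scaling_axioms.intro
        simp: real_vector.vector_space_axioms)
qed

lemma normed_scaling_mult: "normed_scaling ((*) :: 'k::real_normed_field \<Rightarrow> 'k \<Rightarrow> 'k)"
  by unfold_locales (simp_all add: algebra_simps norm_mult scaleR_conv_of_real)

definition pointwise :: "('k \<Rightarrow> 'x \<Rightarrow> 'x) \<Rightarrow> 'k \<Rightarrow> ('d \<Rightarrow> 'x) \<Rightarrow> 'd \<Rightarrow> 'x" where
  "pointwise scl c u = (\<lambda>a. scl c (u a))"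

lemma vector_space_pointwise:
  assumes "vector_space scl"
  shows "vector_space (pointwise scl)"
proof -
  interpret vector_space scl by fact
  show ?thesis
    by unfold_locales
      (simp_all add: pointwise_def fun_eq_iff scale_right_distrib scale_left_distrib)
qed

definition norm_on ::
    "('k::real_normed_field \<Rightarrow> 'x::real_normed_vector \<Rightarrow> 'x) \<Rightarrow> ('d \<Rightarrow> 'x) set \<Rightarrow>
      (('d \<Rightarrow> 'x) \<Rightarrow> real) \<Rightarrow> bool" where
  "norm_on scl V nV \<longleftrightarrow>
    (\<forall>u\<in>V. 0 \<le> nV u) \<and>
    (\<forall>u\<in>V. nV u = 0 \<longleftrightarrow> u = 0) \<and>
    (\<forall>u\<in>V. \<forall>v\<in>V. nV (u + v) \<le> nV u + nV v) \<and>
    (\<forall>c. \<forall>u\<in>V. nV (pointwise scl c u) = norm c * nV u)"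

text \<open>
  A norm is a total function whose values outside its space are irrelevant. Since the locale
  \<^locale>\<open>Metric_space\<close> requires a nonnegative symmetric function on the whole type, the induced
  distance is set to 0 outside the space.
\<close>

definition norm_dist ::
    "('d \<Rightarrow> 'x::ab_group_add) set \<Rightarrow> (('d \<Rightarrow> 'x) \<Rightarrow> real) \<Rightarrow> ('d \<Rightarrow> 'x) \<Rightarrow> ('d \<Rightarrow> 'x) \<Rightarrow> real" where
  "norm_dist V nV u v = (if u \<in> V \<and> v \<in> V then nV (u - v) else 0)"

lemma Metric_space_norm_dist:
  assumes "vector_space scl" "module.subspace (pointwise scl) V" "norm_on scl V nV"
  shows "Metric_space V (norm_dist V nV)"
proof -
  interpret vector_space "pointwise scl"
    using assms(1) by (rule vector_space_pointwise)
  have diff: "u - v \<in> V" if "u \<in> V" "v \<in> V" for u v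
    using subspace_diff[OF assms(2)] that by blast
  have nn: "0 \<le> nV u" and z: "nV u = 0 \<longleftrightarrow> u = 0" if "u \<in> V" for u
    using assms(3) that by (auto simp: norm_on_def)
  have tri: "nV (u + v) \<le> nV u + nV v" if "u \<in> V" "v \<in> V" for u v
    using assms(3) that by (auto simp: norm_on_def)
  have sym: "nV (u - v) = nV (v - u)" if "u \<in> V" "v \<in> V" for u v
  proof -
    have "nV (pointwise scl (- 1) (v - u)) = norm (- 1 :: 'a) * nV (v - u)"
      using assms(3) diff[OF that(2,1)] unfolding norm_on_def by blast
    then show ?thesis
      by simp
  qed
  show ?thesis
  proof
    show "norm_dist V nV u w \<le> norm_dist V nV u v + norm_dist V nV v w"
      if "u \<in> V" "v \<in> V" "w \<in> V" for u v w
      using tri[OF diff[OF that(1,2)] diff[OF that(2,3)]] that by (simp add: norm_dist_def)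
  qed (use diff nn z sym in \<open>auto simp: norm_dist_def\<close>)
qed

definition bk_space ::
    "('k::real_normed_field \<Rightarrow> 'x::real_normed_vector \<Rightarrow> 'x) \<Rightarrow> ('d \<Rightarrow> 'x) set \<Rightarrow>
      (('d \<Rightarrow> 'x) \<Rightarrow> real) \<Rightarrow> bool" where
  "bk_space scl V nV \<longleftrightarrow>
    module.subspace (pointwise scl) V \<and>
    norm_on scl V nV \<and>
    Metric_space.mcomplete V (norm_dist V nV) \<and>
    (\<forall>a. continuous_map (Metric_space.mtopology V (norm_dist V nV)) euclidean (\<lambda>u. u a))"

definition bkn_space ::
    "('k::real_normed_field \<Rightarrow> 'x::real_normed_vector \<Rightarrow> 'x) \<Rightarrow> ('d \<Rightarrow> 'x) set \<Rightarrow>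
      (('d \<Rightarrow> 'x) \<Rightarrow> real) \<Rightarrow> bool" where
  "bkn_space scl V nV \<longleftrightarrow> bk_space scl V nV \<and> (\<forall>a. \<exists>v\<in>V. v a \<noteq> 0)"

definition fun_scale :: "('k \<Rightarrow> 'x \<Rightarrow> 'x) \<Rightarrow> ('d \<Rightarrow> 'k) \<Rightarrow> ('d \<Rightarrow> 'x) \<Rightarrow> 'd \<Rightarrow> 'x" where
  "fun_scale scl v f = (\<lambda>a. scl (v a) (f a))"

definition multipliers ::
    "('k \<Rightarrow> 'x \<Rightarrow> 'x) \<Rightarrow> ('d \<Rightarrow> 'k) set \<Rightarrow> ('d \<Rightarrow> 'x) set \<Rightarrow> ('d \<Rightarrow> 'x) set" where
  "multipliers scl V W = {f. \<forall>v\<in>V. fun_scale scl v f \<in> W}"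

definition multiplier_values ::
    "('k \<Rightarrow> 'x \<Rightarrow> 'x) \<Rightarrow> ('d \<Rightarrow> 'k) set \<Rightarrow> (('d \<Rightarrow> 'k) \<Rightarrow> real) \<Rightarrow> (('d \<Rightarrow> 'x) \<Rightarrow> real) \<Rightarrow>
      ('d \<Rightarrow> 'x) \<Rightarrow> real set" where
  "multiplier_values scl V nV nW f = {nW (fun_scale scl v f) |v. v \<in> V \<and> nV v \<le> 1}"

text \<open>
  On \<^typ>\<open>real\<close>, the supremum is meaningful only for nonempty sets that are bounded above.
  The set below contains the value at \<open>v = 0\<close>; boundedness must be established separately.
\<close>

definition multiplier_norm ::
    "('k \<Rightarrow> 'x \<Rightarrow> 'x) \<Rightarrow> ('d \<Rightarrow> 'k) set \<Rightarrow> (('d \<Rightarrow> 'k) \<Rightarrow> real) \<Rightarrow> (('d \<Rightarrow> 'x) \<Rightarrow> real) \<Rightarrow>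
      ('d \<Rightarrow> 'x) \<Rightarrow> real" where
  "multiplier_norm scl V nV nW f = Sup (multiplier_values scl V nV nW f)"

end

theory Submission imports Defs begin

text \<open>
  For a multiplier \<open>f\<close>, the map \<open>v \<mapsto> v \<cdot> f\<close> from \<open>V\<close> to \<open>W\<close> has a closed graph, because evaluations
  are continuous on both spaces; hence it is bounded and its operator norm is finite. Choosing
  \<open>v\<close> with \<open>v a \<noteq> 0\<close> bounds \<open>f a\<close> by a multiple of the operator norm of \<open>f\<close>. A Cauchy sequence of
  multipliers therefore converges pointwise to some \<open>g\<close>; for each \<open>v\<close> the products \<open>v \<cdot> f\<^sub>n\<close> converge
  in \<open>W\<close>, necessarily to \<open>v \<cdot> g\<close>, and uniformly for \<open>v\<close> in the unit ball.
\<close>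

section \<open>Normed function spaces\<close>

locale function_norm = normed_scaling scl
  for scl :: "'k::real_normed_field \<Rightarrow> 'x::real_normed_vector \<Rightarrow> 'x" +
  fixes V :: "('d \<Rightarrow> 'x) set" and N :: "('d \<Rightarrow> 'x) \<Rightarrow> real"
  assumes subspace: "module.subspace (pointwise scl) V"
    and norm_on: "norm_on scl V N"
begin

sublocale pw: vector_space "pointwise scl"
  by (rule vector_space_pointwise) (rule vector_space_axioms)

sublocale met: Metric_space V "norm_dist V N"
  using vector_space_axioms subspace norm_on by (rule Metric_space_norm_dist)

lemma zero_mem: "0 \<in> V"
  using pw.subspace_0[OF subspace] .

lemma add_mem: "u \<in> V \<Longrightarrow> v \<in> V \<Longrightarrow> u + v \<in> V"
  using pw.subspace_add[OF subspace] .

lemma diff_mem: "u \<in> V \<Longrightarrow> v \<in> V \<Longrightarrow> u - v \<in> V"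
  using pw.subspace_diff[OF subspace] .

lemma scale_mem: "u \<in> V \<Longrightarrow> pointwise scl c u \<in> V"
  using pw.subspace_scale[OF subspace] .

lemma N_nonneg: "u \<in> V \<Longrightarrow> 0 \<le> N u"
  using norm_on by (auto simp: norm_on_def)

lemma N_eq_0: "u \<in> V \<Longrightarrow> N u = 0 \<longleftrightarrow> u = 0"
  using norm_on by (auto simp: norm_on_def)

lemma N_zero: "N 0 = 0"
  using N_eq_0[OF zero_mem] by simp

lemma N_triangle: "u \<in> V \<Longrightarrow> v \<in> V \<Longrightarrow> N (u + v) \<le> N u + N v"
  using norm_on by (auto simp: norm_on_def)

lemma N_scale: "u \<in> V \<Longrightarrow> N (pointwise scl c u) = norm c * N u"
  using norm_on by (auto simp: norm_on_def)

lemma N_minus: "u \<in> V \<Longrightarrow> N (- u) = N u"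
  using N_scale[of u "-1"] by simp

lemma N_diff_commute: "u \<in> V \<Longrightarrow> v \<in> V \<Longrightarrow> N (u - v) = N (v - u)"
  using N_minus[OF diff_mem[of u v]] by simp

lemma N_diff_le: "u \<in> V \<Longrightarrow> v \<in> V \<Longrightarrow> N (u - v) \<le> N u + N v"
  using N_triangle[of u "- v"] N_minus[of v] diff_mem[OF zero_mem, of v] by simp

lemma N_triangle_diff:
  "u \<in> V \<Longrightarrow> v \<in> V \<Longrightarrow> w \<in> V \<Longrightarrow> N (u - w) \<le> N (u - v) + N (v - w)"
  using N_triangle[OF diff_mem[of u v] diff_mem[of v w]] by simp

text \<open>Evaluation is linear, so continuity at \<open>0\<close> gives a bound on a small ball,
  and homogeneity extends it to \<open>V\<close>. Conversely, the bound applied to differences makes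
  evaluation Lipschitz.\<close>

lemma continuous_evaluation_iff:
  "continuous_map met.mtopology euclidean (\<lambda>u. u a) \<longleftrightarrow> (\<exists>C. \<forall>u\<in>V. norm (u a) \<le> C * N u)"
proof
  assume "continuous_map met.mtopology euclidean (\<lambda>u. u a)"
  then have "\<exists>r>0. \<forall>u. u \<in> V \<and> norm_dist V N 0 u < r \<longrightarrow> u a \<in> ball 0 1"
    unfolding met.continuous_map_from_metric using zero_mem
    by (auto dest!: bspec[where x = 0] spec[where x = "ball 0 1"])
  then obtain r where r: "r > 0" "\<And>u. u \<in> V \<Longrightarrow> N u < r \<Longrightarrow> norm (u a) < 1"
    using N_minus zero_mem by (auto simp: norm_dist_def)
  have "norm (u a) \<le> 2 / r * N u" if u: "u \<in> V" for u
  proof (cases "u = 0")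
    case True
    then show ?thesis using N_zero by simp
  next
    case False
    then have pos: "N u > 0"
      using N_nonneg[OF u] N_eq_0[OF u] by linarith
    \<comment> \<open>Scaling by \<open>c\<close> gives norm \<open>r / 2\<close>, strictly inside
      the ball of radius \<open>r\<close>; undoing it produces the factor
      \<open>2 / r\<close>.\<close>
    define c where "c = r / (2 * N u)"
    have c: "c > 0" "c * N u = r / 2"
      using pos r(1) by (simp_all add: c_def)
    have "norm (pointwise scl (of_real c) u a) < 1"
      using r c by (intro r(2) scale_mem u) (simp add: N_scale[OF u])
    then have "c * norm (u a) < 1"
      using c(1) by (simp add: pointwise_def norm_scale)
    then show ?thesis
      using pos r(1) by (simp add: c_def field_simps)
  qed
  then show "\<exists>C. \<forall>u\<in>V. norm (u a) \<le> C * N u" by blast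
next
  assume "\<exists>C. \<forall>u\<in>V. norm (u a) \<le> C * N u"
  then obtain C where C: "\<And>u. u \<in> V \<Longrightarrow> norm (u a) \<le> C * N u" by blast
  show "continuous_map met.mtopology euclidean (\<lambda>u. u a)"
    unfolding met.continuous_map_from_metric
  proof (intro conjI ballI allI impI)
    fix u U assume u: "u \<in> V" and U: "openin euclidean U \<and> u a \<in> U"
    then obtain e where e: "e > 0" "ball (u a) e \<subseteq> U"
      by (metis open_contains_ball open_openin)
    \<comment> \<open>\<open>C\<close> may be zero or negative; \<open>\<bar>C\<bar> + 1\<close> is
      a positive Lipschitz constant, so division by it is safe.\<close>
    have "v a \<in> U" if v: "v \<in> V" "norm_dist V N u v < e / (\<bar>C\<bar> + 1)" for v
    proof -
      have "norm (u a - v a) \<le> C * N (u - v)"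
        using C[OF diff_mem[OF u v(1)]] by simp
      also have "\<dots> \<le> (\<bar>C\<bar> + 1) * N (u - v)"
        using N_nonneg[OF diff_mem[OF u v(1)]] by (intro mult_right_mono) auto
      also have "\<dots> < e"
        using u v by (simp add: norm_dist_def pos_less_divide_eq mult.commute)
      finally show ?thesis
        using e(2) by (auto simp: dist_norm)
    qed
    then show "\<exists>r>0. \<forall>v. v \<in> V \<and> norm_dist V N u v < r \<longrightarrow> v a \<in> U"
      using e(1) by (intro exI[of _ "e / (\<bar>C\<bar> + 1)"]) auto
  qed auto
qed

text \<open>Sequence and limit lie in \<open>V\<close>, so the default value of
  \<open>norm_dist\<close> never occurs and completeness can be handled through norms of differences
  alone.\<close>

lemma mcomplete_iff:
  "met.mcomplete \<longleftrightarrow>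
    (\<forall>x. range x \<subseteq> V \<and> (\<forall>e>0. \<exists>n0. \<forall>m\<ge>n0. \<forall>n\<ge>n0. N (x m - x n) < e) \<longrightarrow>
      (\<exists>l\<in>V. (\<lambda>n. N (x n - l)) \<longlonglongrightarrow> 0))"
proof -
  have "met.MCauchy x \<longleftrightarrow>
      range x \<subseteq> V \<and> (\<forall>e>0. \<exists>n0. \<forall>m\<ge>n0. \<forall>n\<ge>n0. N (x m - x n) < e)" for x
  proof (cases "range x \<subseteq> V")
    case True
    then have "x n \<in> V" for n by blast
    then show ?thesis
      unfolding met.MCauchy_def norm_dist_def by simp
  next
    case False
    then show ?thesis by (simp add: met.MCauchy_def)
  qed
  moreover have "limitin met.mtopology x l sequentially \<longleftrightarrow> l \<in> V \<and> (\<lambda>n. N (x n - l)) \<longlonglongrightarrow> 0"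
    if "range x \<subseteq> V" for x l
    using that by (auto simp: met.limitin_metric_dist_null norm_dist_def subset_iff)
  ultimately show ?thesis
    unfolding met.mcomplete_def by meson
qed

end

section \<open>Complete norms with continuous evaluations\<close>

locale bk_norm = function_norm +
  assumes complete: "met.mcomplete"
    and continuous_evaluation: "continuous_map met.mtopology euclidean (\<lambda>u. u a)"
begin

lemma evaluation_bound:
  obtains C where "C \<ge> 0" "\<And>u. u \<in> V \<Longrightarrow> norm (u a) \<le> C * N u"
proof -
  obtain C where C: "\<And>u. u \<in> V \<Longrightarrow> norm (u a) \<le> C * N u"
    using continuous_evaluation continuous_evaluation_iff by blast
  have "norm (u a) \<le> \<bar>C\<bar> * N u" if "u \<in> V" for u
    using C[OF that] N_nonneg[OF that] by (meson abs_ge_self mult_right_mono order_trans)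
  then show thesis
    using that[of "\<bar>C\<bar>"] by simp
qed

lemma convergentE:
  assumes "range x \<subseteq> V" "\<And>e. e > 0 \<Longrightarrow> \<exists>n0. \<forall>m\<ge>n0. \<forall>n\<ge>n0. N (x m - x n) < e"
  obtains l where "l \<in> V" "(\<lambda>n. N (x n - l)) \<longlonglongrightarrow> 0"
  using complete assms unfolding mcomplete_iff by blast

text \<open>The evaluation bound at \<open>a\<close> applies to \<open>x n - l\<close>. This is the
  tool for identifying a norm limit through its values.\<close>

lemma tendsto_evaluation:
  assumes "range x \<subseteq> V" "l \<in> V" "(\<lambda>n. N (x n - l)) \<longlonglongrightarrow> 0"
  shows "(\<lambda>n. x n a) \<longlonglongrightarrow> l a"
proof -
  obtain C where C: "\<And>u. u \<in> V \<Longrightarrow> norm (u a) \<le> C * N u"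
    using evaluation_bound by blast
  have "(\<lambda>n. C * N (x n - l)) \<longlonglongrightarrow> 0"
    using tendsto_mult_left[OF assms(3), of C] by simp
  moreover have "norm (x n a - l a) \<le> C * N (x n - l)" for n
    using C[OF diff_mem[of "x n" l]] assms(1,2) by auto
  ultimately have "(\<lambda>n. x n a - l a) \<longlonglongrightarrow> 0"
    by (intro Lim_null_comparison[of "\<lambda>n. x n a - l a"]) auto
  then show ?thesis
    by (simp add: LIM_zero_iff)
qed

end

lemma bk_space_iff_bk_norm:
  assumes "normed_scaling scl"
  shows "bk_space scl V N \<longleftrightarrow> bk_norm scl V N"
  using assms
  by (auto simp: bk_space_def bk_norm_def bk_norm_axioms_def function_norm_def
      function_norm_axioms_def)

section \<open>A closed graph theorem\<close>

text \<open>The continuity of \<open>u \<mapsto> T u b\<close> for every \<open>b\<close> makes the graph of \<open>T\<close> closed.\<close>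

locale bk_linear_map =
  A: bk_norm s V N + B: bk_norm t W M
  for s :: "'k::real_normed_field \<Rightarrow> 'x::real_normed_vector \<Rightarrow> 'x"
    and V :: "('d \<Rightarrow> 'x) set" and N
    and t :: "'k \<Rightarrow> 'y::real_normed_vector \<Rightarrow> 'y"
    and W :: "('e \<Rightarrow> 'y) set" and M +
  fixes T :: "('d \<Rightarrow> 'x) \<Rightarrow> 'e \<Rightarrow> 'y"
  assumes linear: "Vector_Spaces.linear (pointwise s) (pointwise t) T"
    and maps: "u \<in> V \<Longrightarrow> T u \<in> W"
    and pointwise_bounded: "\<exists>C. \<forall>u\<in>V. norm (T u b) \<le> C * N u"
begin

sublocale T: Vector_Spaces.linear "pointwise s" "pointwise t" T
  by (rule linear)

text \<open>Baire category: the sublevel sets \<open>S n\<close> cover the complete space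
  \<open>V\<close>, so the closure of one of them contains a ball. Taking differences moves the ball
  to the origin.\<close>

lemma almost_bounded:
  obtains r K where "r > 0" "K \<ge> 0"
    "\<And>y e. y \<in> V \<Longrightarrow> N y < r \<Longrightarrow> e > 0 \<Longrightarrow> \<exists>z\<in>V. M (T z) \<le> K \<and> N (y - z) < e"
proof -
  define S where "S n = {u \<in> V. M (T u) \<le> real n}" for n
  have cover: "\<Union> (range (\<lambda>n. A.met.mtopology closure_of S n)) = V"
  proof
    show "V \<subseteq> \<Union> (range (\<lambda>n. A.met.mtopology closure_of S n))"
    proof
      fix u assume "u \<in> V"
      moreover obtain n where "M (T u) \<le> real n"
        using real_arch_simple by blast
      ultimately have "u \<in> S n" by (simp add: S_def)
      moreover have "S n \<subseteq> A.met.mtopology closure_of S n"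
        by (rule closure_of_subset) (auto simp: S_def)
      ultimately show "u \<in> \<Union> (range (\<lambda>n. A.met.mtopology closure_of S n))"
        by blast
    qed
  qed (use closure_of_subset_topspace in fastforce)
  \<comment> \<open>If all these closures had empty interior, so would their union \<open>V\<close>;
    but \<open>V\<close> is its own interior and contains \<open>0\<close>.\<close>
  have "\<exists>n. A.met.mtopology interior_of (A.met.mtopology closure_of S n) \<noteq> {}"
  proof (rule ccontr)
    assume "\<not> ?thesis"
    then have "A.met.mtopology interior_of
        \<Union> (range (\<lambda>n. A.met.mtopology closure_of S n)) = {}"
      by (intro A.met.metric_Baire_category_alt A.complete) auto
    then show False
      unfolding cover
      using A.zero_mem interior_of_topspace[of A.met.mtopology, unfolded A.met.topspace_mtopology]
      by blast
  qed
  then obtain n x where "x \<in> A.met.mtopology interior_of (A.met.mtopology closure_of S n)"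
    by blast
  then obtain r where r: "r > 0" and x: "x \<in> V"
    and sub: "A.met.mball x r \<subseteq> A.met.mtopology closure_of S n"
    by (auto simp: A.met.in_interior_of_mball)
  have approx: "\<exists>z\<in>V. M (T z) \<le> real n \<and> N (y - z) < e"
    if "y \<in> V" "N (x - y) < r" "e > 0" for y e
  proof -
    have "y \<in> A.met.mtopology closure_of S n"
      using sub that x by (auto simp: norm_dist_def)
    then show ?thesis
      using \<open>e > 0\<close> that(1)
      by (fastforce simp: A.met.metric_closure_of S_def norm_dist_def)
  qed
  show thesis
  proof (rule that)
    show "r > 0" "2 * real n \<ge> 0" using r by auto
    fix y e assume y: "y \<in> V" "N y < r" and e: "(e::real) > 0"
    \<comment> \<open>Write \<open>y\<close> as \<open>(x + y) - x\<close>. Both points lie in the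
      ball around \<open>x\<close>, so each has an approximant from \<open>S n\<close> within
      \<open>e / 2\<close>; the difference of the two costs \<open>2 * real n\<close>.\<close>
    have "N (x - (x + y)) < r"
      using y A.N_minus by simp
    then obtain z1 where z1: "z1 \<in> V" "M (T z1) \<le> real n" "N (x + y - z1) < e / 2"
      using approx[of "x + y" "e / 2"] A.add_mem[OF x y(1)] e by auto
    obtain z2 where z2: "z2 \<in> V" "M (T z2) \<le> real n" "N (x - z2) < e / 2"
      using approx[OF x, of "e / 2"] e r by (auto simp: A.N_zero)
    have "M (T (z1 - z2)) \<le> 2 * real n"
      using B.N_diff_le[OF maps[OF z1(1)] maps[OF z2(1)]] z1(2) z2(2) by (simp add: T.diff)
    moreover have "N (y - (z1 - z2)) < e"
    proof -
      have "N ((x + y - z1) - (x - z2)) \<le> N (x + y - z1) + N (x - z2)"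
        by (intro A.N_diff_le A.diff_mem A.add_mem x y z1 z2)
      moreover have "(x + y - z1) - (x - z2) = y - (z1 - z2)"
        by (simp add: algebra_simps)
      ultimately show ?thesis using z1(3) z2(3) by simp
    qed
    ultimately show "\<exists>z\<in>V. M (T z) \<le> 2 * real n \<and> N (y - z) < e"
      using A.diff_mem[OF z1(1) z2(1)] by blast
  qed
qed

text \<open>The remainders of the successive approximations tend to \<open>0\<close> in \<open>V\<close>, while their images
  form a Cauchy sequence in \<open>W\<close>; evaluation at points identifies the limit of the images as \<open>0\<close>.\<close>

lemma bounded_on_ball:
  obtains r K where "r > 0" "\<And>y. y \<in> V \<Longrightarrow> N y < r \<Longrightarrow> M (T y) \<le> K"
proof -
  obtain r K where r: "r > 0" and K: "K \<ge> 0" and approx: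
    "\<And>y e. y \<in> V \<Longrightarrow> N y < r \<Longrightarrow> e > 0 \<Longrightarrow> \<exists>z\<in>V. M (T z) \<le> K \<and> N (y - z) < e"
    using almost_bounded by blast
  \<comment> \<open>Blow \<open>y\<close> up by \<open>2 ^ k\<close> into the ball of radius
    \<open>r\<close>, approximate there within \<open>r / 2\<close>, and scale back. The new
    remainder is \<open>y\<close> minus the scaled approximant \<open>z\<close>, so
    \<open>T y - T y'\<close> is \<open>T z\<close> divided by \<open>2 ^ k\<close>.\<close>
  have step: "\<exists>y'\<in>V. N y' < r / 2 ^ Suc k \<and> M (T y - T y') \<le> K / 2 ^ k"
    if y: "y \<in> V" "N y < r / 2 ^ k" for y and k :: nat
  proof -
    let ?c = "of_real (2 ^ k) :: 'k" and ?d = "of_real (1 / 2 ^ k) :: 'k"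
    have "N (pointwise s ?c y) < r"
      using y by (simp add: A.N_scale pos_less_divide_eq mult.commute norm_power)
    then obtain z where z: "z \<in> V" "M (T z) \<le> K" "N (pointwise s ?c y - z) < r / 2"
      using approx[of "pointwise s ?c y" "r / 2"] A.scale_mem[OF y(1)] r by auto
    let ?y = "pointwise s ?d (pointwise s ?c y - z)"
    have eq: "y - ?y = pointwise s ?d z"
      by (simp add: A.pw.scale_right_diff_distrib flip: of_real_mult)
    have norm_d: "norm ?d = 1 / 2 ^ k"
      by (simp add: norm_divide norm_power)
    have "?y \<in> V"
      using A.scale_mem A.diff_mem y z by blast
    moreover have "N ?y < r / 2 ^ Suc k"
      unfolding A.N_scale[OF A.diff_mem[OF A.scale_mem[OF y(1)] z(1)]] norm_d
      using z(3) by (simp add: field_simps)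
    moreover have "M (T y - T ?y) \<le> K / 2 ^ k"
    proof -
      have "T y - T ?y = pointwise t ?d (T z)"
        using eq T.diff T.scale by metis
      then show ?thesis
        using z(2) by (simp only: B.N_scale[OF maps[OF z(1)]] norm_d) (simp add: field_simps)
    qed
    ultimately show ?thesis by blast
  qed
  have "M (T y) \<le> 2 * K" if y: "y \<in> V" "N y < r" for y
  proof -
    \<comment> \<open>Dependent choice iterates the step; the clause for \<open>k = 0\<close> pins
      the starting point to \<open>y\<close>.\<close>
    have "\<exists>Y. \<forall>k. (Y k \<in> V \<and> N (Y k) < r / 2 ^ k \<and> (k = 0 \<longrightarrow> Y k = y)) \<and>
        M (T (Y k) - T (Y (Suc k))) \<le> K / 2 ^ k"
    proof (rule dependent_nat_choice)
      show "\<exists>x. x \<in> V \<and> N x < r / 2 ^ 0 \<and> (0 = 0 \<longrightarrow> x = y)"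
        using y by auto
      show "\<exists>x'. (x' \<in> V \<and> N x' < r / 2 ^ Suc k \<and> (Suc k = 0 \<longrightarrow> x' = y)) \<and>
          M (T x - T x') \<le> K / 2 ^ k"
        if "x \<in> V \<and> N x < r / 2 ^ k \<and> (k = 0 \<longrightarrow> x = y)" for x k
        using step[of x k] that by auto
    qed
    then obtain Y where Y: "\<And>k. Y k \<in> V" "\<And>k. N (Y k) < r / 2 ^ k" "Y 0 = y"
      and Y_step: "\<And>k. M (T (Y k) - T (Y (Suc k))) \<le> K / 2 ^ k"
      by blast
    have TY: "T (Y k) \<in> W" for k
      using maps Y(1) by blast
    \<comment> \<open>The right-hand side is the exact value of the geometric sum of
      \<open>K / 2 ^ i\<close> over \<open>k \<le> i < k + j\<close>, so the induction closes
      without loss.\<close>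
    have dist: "M (T (Y k) - T (Y (k + j))) \<le> 2 * K / 2 ^ k - 2 * K / 2 ^ (k + j)" for k j
    proof (induction j)
      case 0
      show ?case by (simp only: add_0_right diff_self B.N_zero)
    next
      case (Suc j)
      have "M (T (Y k) - T (Y (k + Suc j))) \<le>
          M (T (Y k) - T (Y (k + j))) + M (T (Y (k + j)) - T (Y (Suc (k + j))))"
        using B.N_triangle_diff[OF TY TY TY] by simp
      also have "\<dots> \<le> (2 * K / 2 ^ k - 2 * K / 2 ^ (k + j)) + K / 2 ^ (k + j)"
        by (intro add_mono Suc.IH Y_step)
      also have "\<dots> = 2 * K / 2 ^ k - 2 * K / 2 ^ (k + Suc j)"
        by (simp add: field_simps)
      finally show ?case .
    qed
    have dist': "M (T (Y k) - T (Y m)) \<le> 2 * K / 2 ^ k" if "k \<le> m" for k m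
    proof -
      obtain j where m: "m = k + j" using \<open>k \<le> m\<close> le_Suc_ex by blast
      show ?thesis
        using dist[of k j] K unfolding m by (smt (verit) divide_nonneg_pos zero_less_power)
    qed
    have geometric: "(\<lambda>k. c / 2 ^ k) \<longlonglongrightarrow> 0" for c :: real
      using tendsto_mult_right_zero[OF LIMSEQ_power_zero[of "1 / 2 :: real"], of c]
      by (simp add: power_divide)
    obtain w where w: "w \<in> W" "(\<lambda>k. M (T (Y k) - w)) \<longlonglongrightarrow> 0"
    proof (rule B.convergentE)
      show "range (\<lambda>k. T (Y k)) \<subseteq> W" using TY by blast
      fix e :: real assume "e > 0"
      then have "\<forall>\<^sub>F k in sequentially. 2 * K / 2 ^ k < e"
        using geometric order_tendstoD(2) by blast
      then obtain n0 where n0: "\<And>k. k \<ge> n0 \<Longrightarrow> 2 * K / 2 ^ k < e"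
        by (auto simp: eventually_sequentially)
      have "M (T (Y m) - T (Y n)) < e" if "m \<ge> n0" "n \<ge> n0" for m n
        using dist'[of m n] dist'[of n m] n0[OF that(1)] n0[OF that(2)]
          B.N_diff_commute[OF TY[of m] TY[of n]] by (cases m n rule: le_cases) auto
      then show "\<exists>n0. \<forall>m\<ge>n0. \<forall>n\<ge>n0. M (T (Y m) - T (Y n)) < e" by blast
    qed
    have "w b = 0" for b
    proof -
      have "(\<lambda>k. T (Y k) b) \<longlonglongrightarrow> w b"
        using B.tendsto_evaluation[of "\<lambda>k. T (Y k)" w b] TY w by auto
      moreover obtain C where C: "\<And>u. u \<in> V \<Longrightarrow> norm (T u b) \<le> C * N u"
        using pointwise_bounded by blast
      have "(\<lambda>k. T (Y k) b) \<longlonglongrightarrow> 0"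
      proof (rule Lim_null_comparison)
        show "(\<lambda>k. \<bar>C\<bar> * r / 2 ^ k) \<longlonglongrightarrow> 0"
          by (rule geometric)
        have "norm (T (Y k) b) \<le> \<bar>C\<bar> * r / 2 ^ k" for k
        proof -
          have "norm (T (Y k) b) \<le> \<bar>C\<bar> * N (Y k)"
            using C[OF Y(1)[of k]] A.N_nonneg[OF Y(1)[of k]]
            by (meson abs_ge_self mult_right_mono order_trans)
          also have "\<dots> \<le> \<bar>C\<bar> * (r / 2 ^ k)"
            using Y(2)[of k] by (intro mult_left_mono) auto
          finally show ?thesis by simp
        qed
        then show "\<forall>\<^sub>F k in sequentially. norm (T (Y k) b) \<le> \<bar>C\<bar> * r / 2 ^ k"
          by simp
      qed
      ultimately show ?thesis
        using LIMSEQ_unique by blast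
    qed
    then have "w = 0" by (simp add: fun_eq_iff)
    then have lim: "(\<lambda>k. M (T (Y k)) + 2 * K) \<longlonglongrightarrow> 0 + 2 * K"
      using w(2) by (intro tendsto_intros) simp
    \<comment> \<open>Split \<open>T y\<close> into \<open>T (Y k)\<close>, whose norm tends to
      \<open>0\<close>, and \<open>T (Y 0) - T (Y k)\<close>, bounded by \<open>2 * K\<close>
      independently of \<open>k\<close>.\<close>
    have "M (T y) \<le> M (T (Y k)) + 2 * K" for k
      using B.N_triangle[OF TY[of k] B.diff_mem[OF TY[of 0] TY[of k]]] dist'[of 0 k] Y(3)
      by simp
    then have "M (T y) \<le> 0 + 2 * K"
      by (intro LIMSEQ_le_const[OF lim]) auto
    then show ?thesis by simp
  qed
  then show thesis
    using that r by blast
qed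

text \<open>Homogeneity: a nonzero \<open>u\<close> is scaled to norm \<open>r / 2\<close>, inside
  the ball on which the images are bounded by \<open>K\<close>.\<close>

theorem closed_graph:
  obtains C where "\<And>u. u \<in> V \<Longrightarrow> M (T u) \<le> C * N u"
proof -
  obtain r K where r: "r > 0" and K: "\<And>y. y \<in> V \<Longrightarrow> N y < r \<Longrightarrow> M (T y) \<le> K"
    using bounded_on_ball by blast
  have "M (T u) \<le> 2 * K / r * N u" if u: "u \<in> V" for u
  proof (cases "u = 0")
    case True
    then show ?thesis using A.N_zero B.N_zero by simp
  next
    case False
    then have pos: "N u > 0"
      using A.N_nonneg[OF u] A.N_eq_0[OF u] by linarith
    define c where "c = r / (2 * N u)"
    have c: "c > 0" "c * N u = r / 2"
      using pos r by (simp_all add: c_def)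
    have "M (T (pointwise s (of_real c) u)) \<le> K"
      using c r u by (intro K A.scale_mem) (auto simp: A.N_scale)
    then have "c * M (T u) \<le> K"
      using c(1) by (simp add: T.scale B.N_scale[OF maps[OF u]])
    then show ?thesis
      using pos r by (simp add: c_def field_simps)
  qed
  then show thesis using that by blast
qed

end

section \<open>Multipliers\<close>

locale multiplier_spaces =
  V: bk_norm "(*)" V nV + W: bk_norm scl W nW
  for V :: "('d \<Rightarrow> 'k::real_normed_field) set" and nV
    and scl :: "'k \<Rightarrow> 'x::banach \<Rightarrow> 'x" and W :: "('d \<Rightarrow> 'x) set" and nW +
  assumes nonvanishing: "\<exists>v\<in>V. v a \<noteq> 0"
begin

abbreviation "MVW \<equiv> multipliers scl V W"
abbreviation "nM \<equiv> multiplier_norm scl V nV nW"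

section \<open>Algebra of pointwise products\<close>

lemma multiplierD: "f \<in> MVW \<Longrightarrow> v \<in> V \<Longrightarrow> fun_scale scl v f \<in> W"
  by (simp add: multipliers_def)

lemma fun_scale_zero [simp]: "fun_scale scl v 0 = 0" "fun_scale scl 0 f = 0"
  by (simp_all add: fun_scale_def fun_eq_iff)

lemma fun_scale_add: "fun_scale scl v (f + g) = fun_scale scl v f + fun_scale scl v g"
  by (simp add: fun_scale_def fun_eq_iff W.scale_right_distrib)

lemma fun_scale_diff: "fun_scale scl v (f - g) = fun_scale scl v f - fun_scale scl v g"
  by (simp add: fun_scale_def fun_eq_iff W.scale_right_diff_distrib)

lemma fun_scale_pointwise:
  "fun_scale scl v (pointwise scl c f) = pointwise scl c (fun_scale scl v f)"
  by (simp add: fun_scale_def pointwise_def fun_eq_iff mult.commute)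

lemma fun_scale_pointwise_left:
  "fun_scale scl (pointwise (*) c v) f = pointwise scl c (fun_scale scl v f)"
  by (simp add: fun_scale_def pointwise_def fun_eq_iff)

lemma linear_fun_scale:
  "Vector_Spaces.linear (pointwise (*)) (pointwise scl) (\<lambda>v. fun_scale scl v f)"
  by unfold_locales
    (simp_all add: fun_scale_def pointwise_def fun_eq_iff W.scale_left_distrib)

lemma subspace_multipliers: "module.subspace (pointwise scl) MVW"
  by (rule W.pw.subspaceI)
    (auto simp: multipliers_def fun_scale_add fun_scale_pointwise
      intro: W.zero_mem W.add_mem W.scale_mem)

text \<open>The closed graph theorem applies to \<open>v \<mapsto> fun_scale scl v f\<close>: its
  value at \<open>b\<close> has norm \<open>norm (v b) * norm (f b)\<close>, and evaluation at
  \<open>b\<close> is bounded on \<open>V\<close>.\<close>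

lemma bounded_multiplier:
  assumes f: "f \<in> MVW"
  obtains C where "\<And>v. v \<in> V \<Longrightarrow> nW (fun_scale scl v f) \<le> C * nV v"
proof -
  interpret bk_linear_map "(*)" V nV scl W nW "\<lambda>v. fun_scale scl v f"
  proof (intro bk_linear_map.intro bk_linear_map_axioms.intro)
    show "bk_norm (*) V nV" "bk_norm scl W nW"
      by unfold_locales
    fix b
    obtain C where C: "\<And>v. v \<in> V \<Longrightarrow> norm (v b) \<le> C * nV v"
      using V.evaluation_bound by blast
    have "norm (fun_scale scl v f b) \<le> C * norm (f b) * nV v" if "v \<in> V" for v
      using mult_right_mono[OF C[OF that] norm_ge_zero[of "f b"]]
      by (simp add: fun_scale_def W.norm_scale mult_ac)
    then show "\<exists>C. \<forall>v\<in>V. norm (fun_scale scl v f b) \<le> C * nV v" by blast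
  qed (use linear_fun_scale multiplierD[OF f] in auto)
  show thesis using closed_graph that by blast
qed

text \<open>This makes the \<open>Sup\<close> in \<open>multiplier_norm\<close> a genuine supremum
  for every multiplier.\<close>

lemma bdd_above_multiplier_values:
  assumes f: "f \<in> MVW"
  shows "bdd_above (multiplier_values scl V nV nW f)"
proof -
  obtain C where C: "\<And>v. v \<in> V \<Longrightarrow> nW (fun_scale scl v f) \<le> C * nV v"
    using bounded_multiplier[OF f] by blast
  have "nW (fun_scale scl v f) \<le> \<bar>C\<bar>" if "v \<in> V" "nV v \<le> 1" for v
  proof -
    have "C * nV v \<le> \<bar>C\<bar> * 1"
      using V.N_nonneg[OF that(1)] that(2) by (intro mult_mono) auto
    then show ?thesis using C[OF that(1)] by simp
  qed
  then show ?thesis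
    by (intro bdd_aboveI[of _ "\<bar>C\<bar>"]) (auto simp: multiplier_values_def)
qed

section \<open>Estimates for the operator norm\<close>

lemma multiplier_norm_upper:
  "f \<in> MVW \<Longrightarrow> v \<in> V \<Longrightarrow> nV v \<le> 1 \<Longrightarrow> nW (fun_scale scl v f) \<le> nM f"
  unfolding multiplier_norm_def
  by (intro cSup_upper bdd_above_multiplier_values) (auto simp: multiplier_values_def)

lemma multiplier_norm_least:
  assumes "\<And>v. v \<in> V \<Longrightarrow> nV v \<le> 1 \<Longrightarrow> nW (fun_scale scl v f) \<le> c"
  shows "nM f \<le> c"
  unfolding multiplier_norm_def
proof (rule cSup_least)
  show "multiplier_values scl V nV nW f \<noteq> {}"
    using V.zero_mem by (auto simp: multiplier_values_def V.N_zero intro!: exI[of _ 0])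
qed (use assms in \<open>auto simp: multiplier_values_def\<close>)

lemma multiplier_norm_nonneg: "f \<in> MVW \<Longrightarrow> 0 \<le> nM f"
  using multiplier_norm_upper[OF _ V.zero_mem] by (simp add: V.N_zero W.N_zero)

text \<open>A nonzero \<open>v\<close> is normalised to norm \<open>1\<close>, where the supremum
  applies directly.\<close>

lemma multiplier_norm_bound:
  assumes f: "f \<in> MVW" and v: "v \<in> V"
  shows "nW (fun_scale scl v f) \<le> nM f * nV v"
proof (cases "v = 0")
  case True
  then show ?thesis by (simp add: V.N_zero W.N_zero)
next
  case False
  then have pos: "nV v > 0"
    using V.N_nonneg[OF v] V.N_eq_0[OF v] by linarith
  let ?c = "of_real (1 / nV v) :: 'k"
  have norm_c: "norm ?c = 1 / nV v"
    using pos by (simp add: norm_divide)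
  have "nW (fun_scale scl (pointwise (*) ?c v) f) \<le> nM f"
    using pos by (intro multiplier_norm_upper f V.scale_mem v) (simp only: V.N_scale[OF v] norm_c, simp)
  then have "nW (fun_scale scl v f) / nV v \<le> nM f"
    unfolding fun_scale_pointwise_left W.N_scale[OF multiplierD[OF f v]] norm_c by simp
  then show ?thesis
    using pos by (simp add: pos_divide_le_eq)
qed

text \<open>Nonvanishing enters here: with \<open>v a \<noteq> 0\<close>, the value
  \<open>f a\<close> is recovered from that of the product at \<open>a\<close>, which the norm of
  \<open>W\<close> controls. The bound yields definiteness of the operator norm, pointwise
  convergence of Cauchy sequences and continuity of evaluations.\<close>

lemma multiplier_evaluation_bound: "\<exists>C. \<forall>f\<in>MVW. norm (f a) \<le> C * nM f"
proof -
  obtain v where v: "v \<in> V" "v a \<noteq> 0"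
    using nonvanishing by blast
  obtain C where C: "C \<ge> 0" "\<And>w. w \<in> W \<Longrightarrow> norm (w a) \<le> C * nW w"
    using W.evaluation_bound by blast
  have "norm (f a) \<le> C * nV v / norm (v a) * nM f" if f: "f \<in> MVW" for f
  proof -
    have "norm (v a) * norm (f a) \<le> C * nW (fun_scale scl v f)"
      using C(2)[OF multiplierD[OF f v(1)]] by (simp add: fun_scale_def W.norm_scale)
    also have "\<dots> \<le> C * (nM f * nV v)"
      using C(1) multiplier_norm_bound[OF f v(1)] by (intro mult_left_mono)
    finally show ?thesis
      using v(2) by (simp add: field_simps)
  qed
  then show ?thesis by blast
qed

section \<open>The norm axioms for the operator norm\<close>

lemma norm_on_multipliers: "norm_on scl MVW nM"
proof -
  have zero: "nM 0 = 0"
    using multiplier_norm_least[of 0 0] multiplier_norm_nonneg[of 0]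
      W.pw.subspace_0[OF subspace_multipliers] by (simp add: W.N_zero)
  have scale_le: "nM (pointwise scl c f) \<le> norm c * nM f" if f: "f \<in> MVW" for c f
  proof (rule multiplier_norm_least)
    fix v assume v: "v \<in> V" "nV v \<le> 1"
    show "nW (fun_scale scl v (pointwise scl c f)) \<le> norm c * nM f"
      unfolding fun_scale_pointwise W.N_scale[OF multiplierD[OF f v(1)]]
      using multiplier_norm_upper[OF f v] by (intro mult_left_mono) auto
  qed
  show ?thesis
    unfolding norm_on_def
  proof (intro conjI ballI allI)
    fix f assume f: "f \<in> MVW"
    show "0 \<le> nM f" using multiplier_norm_nonneg[OF f] .
    have "f = 0" if "nM f = 0"
    proof
      fix a
      obtain C where "\<forall>f\<in>MVW. norm (f a) \<le> C * nM f"
        using multiplier_evaluation_bound by blast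
      then show "f a = 0 a"
        using f that by fastforce
    qed
    then show "(nM f = 0) = (f = 0)" using zero by auto
  next
    fix f g assume f: "f \<in> MVW" and g: "g \<in> MVW"
    show "nM (f + g) \<le> nM f + nM g"
    proof (rule multiplier_norm_least)
      fix v assume v: "v \<in> V" "nV v \<le> 1"
      have "nW (fun_scale scl v (f + g)) \<le> nW (fun_scale scl v f) + nW (fun_scale scl v g)"
        unfolding fun_scale_add by (intro W.N_triangle multiplierD f g v)
      also have "\<dots> \<le> nM f + nM g"
        by (intro add_mono multiplier_norm_upper f g v)
      finally show "nW (fun_scale scl v (f + g)) \<le> nM f + nM g" .
    qed
  next
    fix c f assume f: "f \<in> MVW"
    show "nM (pointwise scl c f) = norm c * nM f"
    proof (cases "c = 0")
      case True
      then show ?thesis by (simp add: zero)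
    next
      case False
      \<comment> \<open>The reverse inequality is \<open>scale_le\<close> for the scalar
        \<open>inverse c\<close> and the multiplier \<open>pointwise scl c f\<close>.\<close>
      have "nM (pointwise scl (inverse c) (pointwise scl c f)) \<le>
          norm (inverse c) * nM (pointwise scl c f)"
        by (intro scale_le W.pw.subspace_scale[OF subspace_multipliers] f)
      then have "norm c * nM f \<le> nM (pointwise scl c f)"
        using False by (simp add: norm_divide field_simps)
      then show ?thesis
        using scale_le[OF f, of c] by simp
    qed
  qed
qed

sublocale M: function_norm scl MVW nM
  by unfold_locales (rule subspace_multipliers norm_on_multipliers)+

section \<open>Completeness of the multiplier space\<close>

lemma multipliers_complete:
  assumes f: "range f \<subseteq> MVW"
    and Cauchy: "\<And>e. e > 0 \<Longrightarrow> \<exists>n0. \<forall>m\<ge>n0. \<forall>n\<ge>n0. nM (f m - f n) < e"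
  shows "\<exists>g\<in>MVW. (\<lambda>n. nM (f n - g)) \<longlonglongrightarrow> 0"
proof -
  have fM: "f n \<in> MVW" for n
    using f by blast
  have "Cauchy (\<lambda>n. f n a)" for a
  proof (rule CauchyI)
    fix e :: real assume e: "e > 0"
    obtain C where C: "\<And>f. f \<in> MVW \<Longrightarrow> norm (f a) \<le> C * nM f"
      using multiplier_evaluation_bound by blast
    obtain n0 where n0: "\<And>m n. m \<ge> n0 \<Longrightarrow> n \<ge> n0 \<Longrightarrow> nM (f m - f n) < e / (\<bar>C\<bar> + 1)"
      using Cauchy[of "e / (\<bar>C\<bar> + 1)"] e by auto
    have "norm (f m a - f n a) < e" if "m \<ge> n0" "n \<ge> n0" for m n
    proof -
      have "norm (f m a - f n a) \<le> C * nM (f m - f n)"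
        using C[OF M.diff_mem[OF fM fM]] by (metis minus_apply)
      also have "\<dots> \<le> (\<bar>C\<bar> + 1) * nM (f m - f n)"
        using M.N_nonneg[OF M.diff_mem[OF fM fM]] by (intro mult_right_mono) auto
      also have "\<dots> < e"
        using n0[OF that] by (simp add: pos_less_divide_eq mult.commute)
      finally show ?thesis .
    qed
    then show "\<exists>n0. \<forall>m\<ge>n0. \<forall>n\<ge>n0. norm (f m a - f n a) < e" by blast
  qed
  \<comment> \<open>Completeness of the value space \<open>'x\<close> provides the pointwise
    limits.\<close>
  then have "\<exists>l. (\<lambda>n. f n a) \<longlonglongrightarrow> l" for a
    using Cauchy_convergent_iff convergent_def by blast
  then obtain g where g: "\<And>a. (\<lambda>n. f n a) \<longlonglongrightarrow> g a"
    by metis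
  \<comment> \<open>For fixed \<open>v\<close> the products are Cauchy in \<open>W\<close> by
    \<open>multiplier_norm_bound\<close>. Their norm limit \<open>w\<close> is also their pointwise
    limit, hence equals \<open>fun_scale scl v g\<close>.\<close>
  have limit: "fun_scale scl v g \<in> W \<and>
      (\<lambda>n. nW (fun_scale scl v (f n) - fun_scale scl v g)) \<longlonglongrightarrow> 0" if v: "v \<in> V" for v
  proof -
    let ?h = "\<lambda>n. fun_scale scl v (f n)"
    have h: "?h n \<in> W" for n
      using multiplierD fM v by blast
    obtain w where w: "w \<in> W" "(\<lambda>n. nW (?h n - w)) \<longlonglongrightarrow> 0"
    proof (rule W.convergentE)
      show "range ?h \<subseteq> W" using h by blast
      fix e :: real assume e: "e > 0"
      have nn: "nV v \<ge> 0" using V.N_nonneg[OF v] .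
      \<comment> \<open>The summand \<open>1\<close> keeps the divisor positive when
        \<open>v = 0\<close>.\<close>
      obtain n0 where n0: "\<And>m n. m \<ge> n0 \<Longrightarrow> n \<ge> n0 \<Longrightarrow> nM (f m - f n) < e / (nV v + 1)"
        using Cauchy[of "e / (nV v + 1)"] e nn by auto
      have "nW (?h m - ?h n) < e" if "m \<ge> n0" "n \<ge> n0" for m n
      proof -
        have "nW (?h m - ?h n) \<le> nM (f m - f n) * nV v"
          using multiplier_norm_bound[OF M.diff_mem[OF fM fM] v] by (simp add: fun_scale_diff)
        also have "\<dots> \<le> nM (f m - f n) * (nV v + 1)"
          using M.N_nonneg[OF M.diff_mem[OF fM fM]] by (intro mult_left_mono) auto
        also have "\<dots> < e"
          using n0[OF that] nn by (simp add: pos_less_divide_eq)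
        finally show ?thesis .
      qed
      then show "\<exists>n0. \<forall>m\<ge>n0. \<forall>n\<ge>n0. nW (?h m - ?h n) < e" by blast
    qed
    have "w a = fun_scale scl v g a" for a
    proof (rule LIMSEQ_unique)
      show "(\<lambda>n. ?h n a) \<longlonglongrightarrow> w a"
        using W.tendsto_evaluation[of ?h w a] h w by auto
      \<comment> \<open>Multiplication by the fixed scalar \<open>v a\<close> preserves limits
        because \<open>norm_scale\<close> makes the norm multiplicative.\<close>
      have "(\<lambda>n. norm (v a) * norm (f n a - g a)) \<longlonglongrightarrow> norm (v a) * 0"
        using g[of a] by (intro tendsto_intros tendsto_norm_zero) (simp add: LIM_zero_iff)
      then have "(\<lambda>n. norm (?h n a - fun_scale scl v g a)) \<longlonglongrightarrow> 0"
        by (simp add: fun_scale_def flip: W.scale_right_diff_distrib W.norm_scale)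
      then show "(\<lambda>n. ?h n a) \<longlonglongrightarrow> fun_scale scl v g a"
        using tendsto_norm_zero_iff LIM_zero_iff by blast
    qed
    then have "w = fun_scale scl v g" by blast
    then show ?thesis using w by simp
  qed
  have gM: "g \<in> MVW"
    using limit by (simp add: multipliers_def)
  have "(\<lambda>n. nM (f n - g)) \<longlonglongrightarrow> 0"
  proof (rule LIMSEQ_I)
    fix e :: real assume e: "e > 0"
    obtain n0 where n0: "\<And>m n. m \<ge> n0 \<Longrightarrow> n \<ge> n0 \<Longrightarrow> nM (f m - f n) < e / 2"
      using Cauchy[of "e / 2"] e by auto
    \<comment> \<open>The index \<open>n0\<close> is chosen before \<open>v\<close>. For each
      \<open>v\<close> in the unit ball, letting \<open>m\<close> tend to infinity gives the
      non-strict bound \<open>e / 2\<close>, so the supremum over \<open>v\<close> stays below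
      \<open>e\<close>.\<close>
    have "nM (f n - g) \<le> e / 2" if n: "n \<ge> n0" for n
    proof (rule multiplier_norm_least)
      fix v assume v: "v \<in> V" "nV v \<le> 1"
      let ?h = "\<lambda>n. fun_scale scl v (f n)" and ?w = "fun_scale scl v g"
      have h: "?h m \<in> W" for m
        using multiplierD fM v by blast
      have lim: "(\<lambda>m. e / 2 + nW (?h m - ?w)) \<longlonglongrightarrow> e / 2 + 0"
        using limit[OF v(1)] by (intro tendsto_intros) simp
      have "nW (?h n - ?w) \<le> e / 2 + nW (?h m - ?w)" if m: "m \<ge> n0" for m
      proof -
        have "nW (?h n - ?h m) \<le> nM (f n - f m)"
          using multiplier_norm_upper[OF M.diff_mem[OF fM fM] v] by (simp add: fun_scale_diff)
        then show ?thesis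
          using n0[OF n m] W.N_triangle_diff[OF h h, of ?w n m] limit[OF v(1)] by simp
      qed
      then have "nW (?h n - ?w) \<le> e / 2 + 0"
        by (intro LIMSEQ_le_const[OF lim]) blast
      then show "nW (fun_scale scl v (f n - g)) \<le> e / 2"
        by (simp add: fun_scale_diff)
    qed
    then have "norm (nM (f n - g) - 0) < e" if "n \<ge> n0" for n
      using that e M.N_nonneg[OF M.diff_mem[OF fM gM]] by fastforce
    then show "\<exists>n0. \<forall>n\<ge>n0. norm (nM (f n - g) - 0) < e" by blast
  qed
  then show ?thesis using gM by blast
qed

lemma bk_norm_multipliers: "bk_norm scl MVW nM"
proof (intro bk_norm.intro bk_norm_axioms.intro M.function_norm_axioms)
  show "M.met.mcomplete"
    unfolding M.mcomplete_iff
  proof (intro allI impI)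
    fix f :: "nat \<Rightarrow> 'd \<Rightarrow> 'x"
    assume "range f \<subseteq> MVW \<and> (\<forall>e>0. \<exists>n0. \<forall>m\<ge>n0. \<forall>n\<ge>n0. nM (f m - f n) < e)"
    then show "\<exists>g\<in>MVW. (\<lambda>n. nM (f n - g)) \<longlonglongrightarrow> 0"
      by (intro multipliers_complete) simp_all
  qed
  show "continuous_map M.met.mtopology euclidean (\<lambda>u. u a)" for a
    unfolding M.continuous_evaluation_iff by (rule multiplier_evaluation_bound)
qed

end

text \<open>The first conjunct certifies that the operator norm in the second is a true supremum on
  the multiplier space.\<close>

theorem theorem6p1:
  fixes scl :: "'k::real_normed_field \<Rightarrow> 'x::banach \<Rightarrow> 'x"
    and V :: "('d \<Rightarrow> 'k) set" and nV :: "('d \<Rightarrow> 'k) \<Rightarrow> real"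
    and W :: "('d \<Rightarrow> 'x) set" and nW :: "('d \<Rightarrow> 'x) \<Rightarrow> real"
  assumes "normed_scaling scl"
    and "bkn_space (*) V nV"
    and "bk_space scl W nW"
  shows "(\<forall>f\<in>multipliers scl V W. bdd_above (multiplier_values scl V nV nW f)) \<and>
    bk_space scl (multipliers scl V W) (multiplier_norm scl V nV nW)"
proof -
  have "bk_norm (*) V nV" "bk_norm scl W nW"
    using assms bk_space_iff_bk_norm normed_scaling_mult unfolding bkn_space_def by blast+
  moreover have "\<exists>v\<in>V. v a \<noteq> 0" for a
    using assms(2) by (simp add: bkn_space_def)
  ultimately have "multiplier_spaces V nV scl W nW"
    by (intro multiplier_spaces.intro multiplier_spaces_axioms.intro)
  then interpret multiplier_spaces V nV scl W nW .
  show ?thesis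
  proof (intro conjI ballI)
    show "bk_space scl MVW nM"
      unfolding bk_space_iff_bk_norm[OF assms(1)] by (rule bk_norm_multipliers)
  qed (rule bdd_above_multiplier_values)
qed

end
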